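(* Let $X$ be a set and let $\mathscr{A}$ and $\mathscr{B}$ be collections of families of subsets of $X$. Then $X$ satisfies the principle $\mathbf{SCS}_{fin}(\mathscr{A},\mathscr{B})$ if and only if $X$ satisfies the principle $\mathbf{SDS}_{fin}(\mathscr{A}^c,\mathscr{B}^c)$.
   Context: For $U\subseteq X$, $U^c=X\setminus U$; for a family $\mathcal{U}$ of subsets of $X$, $\mathcal{U}^c=\{U^c:U\in\mathcal{U}\}$; for a collection $\mathscr{U}$ of families of subsets of $X$, $\mathscr{U}^c=\{\mathcal{U}^c:\mathcal{U}\in\mathscr{U}\}$. For a set $Y$, $[Y]^{<\omega}$ is the collection of all finite subsets of $Y$ (including $\emptyset$). For the empty family of subsets of $X$, $\bigcup\emptyset=\emptyset$ and $\bigcap\emptyset=X$. For collections $\mathscr{A},\mathscr{B}$ of families of subsets of $X$: $\mathbf{SCS}_{fin}(\mathscr{A},\mathscr{B})$: for any sequence $\{\mathcal{U}_n:n\in\omega\}$ of elements of $\mathscr{A}$ there is a sequence $\{U_n^f:n\in\omega\}$ such that, for each $n\in\omega$, $U_n^f=\{x_n^1,\dots,x_n^{k_n}\}$ is a finite subset of $X$, and $\bigcup\{\mathcal{V}_n^i:n\in\omega\text{ and }i\in\{1,\dots,k_n\}\}\in\mathscr{B}$, where $\mathcal{V}_n^i=\{\bigcup\mathcal{V}:\mathcal{V}\in[\mathcal{U}_n]^{<\omega}\text{ and }x_n^i\in V\text{ for each }V\in\mathcal{V}\}$. $\mathbf{SDS}_{fin}(\mathscr{A},\mathscr{B})$: for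 any sequence $\{\mathcal{D}_n:n\in\omega\}$ of elements of $\mathscr{A}$ there is a sequence $\{D_n^f:n\in\omega\}$ such that, for each $n\in\omega$, $D_n^f=\{x_n^1,\dots,x_n^{k_n}\}$ is a finite subset of $X$, and $\bigcup\{\mathcal{F}_n^i:n\in\omega\text{ and }i\in\{1,\dots,k_n\}\}\in\mathscr{B}$, where $\mathcal{F}_n^i=\{\bigcap\mathcal{F}:\mathcal{F}\in[\mathcal{D}_n]^{<\omega}\text{ and }x_n^i\in E^c\text{ for each }E\in\mathcal{F}\}$. *)

theory Defs
  imports Main
begin

definition fam_compl :: "'a set \<Rightarrow> 'a set set \<Rightarrow> 'a set set" where
  "fam_compl X \<U> = {X - U | U. U \<in> \<U>}"

definition coll_compl :: "'a set \<Rightarrow> 'a set set set \<Rightarrow> 'a set set set" where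
  "coll_compl X \<A> = {fam_compl X \<U> | \<U>. \<U> \<in> \<A>}"

text \<open>Intersection of a family of subsets of \<open>X\<close>: the empty family has intersection \<open>X\<close>
  (the library's \<open>\<Inter>{}\<close> is the whole type).\<close>

definition Inter_in :: "'a set \<Rightarrow> 'a set set \<Rightarrow> 'a set" where
  "Inter_in X \<F> = (if \<F> = {} then X else \<Inter>\<F>)"

definition star_unions :: "'a set set \<Rightarrow> 'a \<Rightarrow> 'a set set" where
  "star_unions \<U> x = {\<Union>\<V> | \<V>. finite \<V> \<and> \<V> \<subseteq> \<U> \<and> (\<forall>V\<in>\<V>. x \<in> V)}"

definition costar_inters :: "'a set \<Rightarrow> 'a set set \<Rightarrow> 'a \<Rightarrow> 'a set set" where
  "costar_inters X \<D> x =
    {Inter_in X \<F> | \<F>. finite \<F> \<and> \<F> \<subseteq> \<D> \<and> (\<forall>E\<in>\<F>. x \<in> X - E)}"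

text \<open>In the two principles the finite sets \<open>{x\<^sub>n\<^sup>1, \<dots>, x\<^sub>n\<^sup>k}\<close> are the values \<open>P n\<close>; the union over
  the indices \<open>i\<close> is taken over the points themselves. The finite sets may be empty.\<close>

definition SCS_fin :: "'a set \<Rightarrow> 'a set set set \<Rightarrow> 'a set set set \<Rightarrow> bool" where
  "SCS_fin X \<A> \<B> \<longleftrightarrow>
    (\<forall>\<U> :: nat \<Rightarrow> 'a set set. (\<forall>n. \<U> n \<in> \<A>) \<longrightarrow>
      (\<exists>P :: nat \<Rightarrow> 'a set. (\<forall>n. finite (P n) \<and> P n \<subseteq> X) \<and>
        (\<Union>n. \<Union>x\<in>P n. star_unions (\<U> n) x) \<in> \<B>))"

definition SDS_fin :: "'a set \<Rightarrow> 'a set set set \<Rightarrow> 'a set set set \<Rightarrow> bool" where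
  "SDS_fin X \<A> \<B> \<longleftrightarrow>
    (\<forall>\<D> :: nat \<Rightarrow> 'a set set. (\<forall>n. \<D> n \<in> \<A>) \<longrightarrow>
      (\<exists>P :: nat \<Rightarrow> 'a set. (\<forall>n. finite (P n) \<and> P n \<subseteq> X) \<and>
        (\<Union>n. \<Union>x\<in>P n. costar_inters X (\<D> n) x) \<in> \<B>))"

end

theory Submission
  imports Defs
begin

text \<open>Complementation in \<open>X\<close> is an involution on the families of subsets of \<open>X\<close>. By De Morgan's
  laws it carries the family \<open>star_unions \<U> x\<close> to \<open>costar_inters X (fam_compl X \<U>) x\<close>, for
  every \<open>x \<in> X\<close> (lemma \<open>costar_inters_fam_compl\<close>); the empty subfamily, with union \<open>{}\<close>,
  corresponds to the empty subfamily with intersection \<open>X\<close>. Hence the same finite sets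
  of points witness the selection for a sequence from \<open>\<A>\<close> and for the sequence of complements
  from \<open>coll_compl X \<A>\<close>.\<close>

lemma fam_compl_eq_image: "fam_compl X \<U> = (\<lambda>U. X - U) ` \<U>"
  by (auto simp: fam_compl_def)

lemma fam_compl_fam_compl:
  assumes "\<U> \<subseteq> Pow X"
  shows "fam_compl X (fam_compl X \<U>) = \<U>"
proof -
  have "X - (X - U) = U" if "U \<in> \<U>" for U
    using assms that by blast
  then show ?thesis
    by (simp add: fam_compl_eq_image image_image)
qed

lemma fam_compl_mem_coll_compl_iff:
  assumes "\<B> \<subseteq> Pow (Pow X)" "\<F> \<subseteq> Pow X"
  shows "fam_compl X \<F> \<in> coll_compl X \<B> \<longleftrightarrow> \<F> \<in> \<B>"
proof
  assume "fam_compl X \<F> \<in> coll_compl X \<B>"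
  then obtain \<G> where "\<G> \<in> \<B>" "fam_compl X \<F> = fam_compl X \<G>"
    by (auto simp: coll_compl_def)
  moreover have "\<G> \<subseteq> Pow X"
    using assms(1) \<open>\<G> \<in> \<B>\<close> by blast
  ultimately show "\<F> \<in> \<B>"
    using assms(2) fam_compl_fam_compl by metis
qed (auto simp: coll_compl_def)

lemma Inter_in_fam_compl: "Inter_in X (fam_compl X \<V>) = X - \<Union>\<V>"
  by (auto simp: Inter_in_def fam_compl_eq_image)

lemma star_unions_subset:
  assumes "\<U> \<subseteq> Pow X"
  shows "star_unions \<U> x \<subseteq> Pow X"
  using assms by (fastforce simp: star_unions_def)

lemma costar_inters_fam_compl:
  assumes "\<U> \<subseteq> Pow X" "x \<in> X"
  shows "costar_inters X (fam_compl X \<U>) x = fam_compl X (star_unions \<U> x)"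
proof (intro equalityI subsetI)
  fix S assume "S \<in> costar_inters X (fam_compl X \<U>) x"
  then obtain \<F> where \<F>: "finite \<F>" "\<F> \<subseteq> (\<lambda>U. X - U) ` \<U>" "\<forall>E\<in>\<F>. x \<in> X - E"
      and S: "S = Inter_in X \<F>"
    by (auto simp: costar_inters_def fam_compl_eq_image)
  then obtain \<V> where \<V>: "finite \<V>" "\<V> \<subseteq> \<U>" "\<F> = fam_compl X \<V>"
    by (metis finite_subset_image fam_compl_eq_image)
  moreover have "\<forall>V\<in>\<V>. x \<in> V"
    using \<F>(3) \<V>(3) assms(2) by (auto simp: fam_compl_eq_image)
  ultimately have "\<Union>\<V> \<in> star_unions \<U> x"
    by (auto simp: star_unions_def)
  then show "S \<in> fam_compl X (star_unions \<U> x)"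
    unfolding S \<V>(3) Inter_in_fam_compl by (auto simp: fam_compl_eq_image)
next
  fix S assume "S \<in> fam_compl X (star_unions \<U> x)"
  then obtain \<V> where \<V>: "finite \<V>" "\<V> \<subseteq> \<U>" "\<forall>V\<in>\<V>. x \<in> V" and S: "S = X - \<Union>\<V>"
    by (auto simp: star_unions_def fam_compl_eq_image)
  have "finite (fam_compl X \<V>)" "fam_compl X \<V> \<subseteq> fam_compl X \<U>"
      "\<forall>E\<in>fam_compl X \<V>. x \<in> X - E"
    using \<V> assms(2) by (auto simp: fam_compl_eq_image)
  then show "S \<in> costar_inters X (fam_compl X \<U>) x"
    unfolding costar_inters_def S Inter_in_fam_compl[symmetric] by blast
qed

text \<open>The selections made from \<open>\<U>\<close> and from its complements by the same points either both
  succeed or both fail.\<close>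

lemma costar_selection_iff_star_selection:
  assumes "\<B> \<subseteq> Pow (Pow X)" "\<And>n. \<U> n \<subseteq> Pow X" "\<And>n. P n \<subseteq> X"
  shows "(\<Union>n. \<Union>x\<in>P n. costar_inters X (fam_compl X (\<U> n)) x) \<in> coll_compl X \<B>
    \<longleftrightarrow> (\<Union>n. \<Union>x\<in>P n. star_unions (\<U> n) x) \<in> \<B>"
proof -
  have "(\<Union>x\<in>P n. costar_inters X (fam_compl X (\<U> n)) x)
      = (\<Union>x\<in>P n. fam_compl X (star_unions (\<U> n) x))" for n
    using assms(3)[of n] costar_inters_fam_compl[OF assms(2)] by (intro SUP_cong) auto
  then have "(\<Union>n. \<Union>x\<in>P n. costar_inters X (fam_compl X (\<U> n)) x)
      = fam_compl X (\<Union>n. \<Union>x\<in>P n. star_unions (\<U> n) x)"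
    by (simp add: fam_compl_eq_image image_UN)
  moreover have "(\<Union>n. \<Union>x\<in>P n. star_unions (\<U> n) x) \<subseteq> Pow X"
    using star_unions_subset[OF assms(2)] by blast
  ultimately show ?thesis
    by (simp add: fam_compl_mem_coll_compl_iff[OF assms(1)])
qed

theorem theorem3p10:
  fixes X :: "'a set" and \<A> \<B> :: "'a set set set"
  assumes "\<A> \<subseteq> Pow (Pow X)" and "\<B> \<subseteq> Pow (Pow X)"
  shows "SCS_fin X \<A> \<B> \<longleftrightarrow> SDS_fin X (coll_compl X \<A>) (coll_compl X \<B>)"
proof
  assume SCS: "SCS_fin X \<A> \<B>"
  show "SDS_fin X (coll_compl X \<A>) (coll_compl X \<B>)"
    unfolding SDS_fin_def
  proof (intro allI impI)
    fix \<D> :: "nat \<Rightarrow> 'a set set"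
    assume "\<forall>n. \<D> n \<in> coll_compl X \<A>"
    then have "\<forall>n. \<exists>\<U>. \<U> \<in> \<A> \<and> \<D> n = fam_compl X \<U>"
      by (auto simp: coll_compl_def)
    then obtain \<U> where \<U>: "\<And>n. \<U> n \<in> \<A>" "\<And>n. \<D> n = fam_compl X (\<U> n)"
      by metis
    then obtain P where P: "\<forall>n. finite (P n) \<and> P n \<subseteq> X"
        "(\<Union>n. \<Union>x\<in>P n. star_unions (\<U> n) x) \<in> \<B>"
      using SCS unfolding SCS_fin_def by meson
    have "\<U> n \<subseteq> Pow X" for n
      using assms(1) \<U>(1) by blast
    then have "(\<Union>n. \<Union>x\<in>P n. costar_inters X (\<D> n) x) \<in> coll_compl X \<B>"
      using costar_selection_iff_star_selection[OF assms(2), of \<U> P] P \<U>(2) by simp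
    with P(1) show "\<exists>P. (\<forall>n. finite (P n) \<and> P n \<subseteq> X) \<and>
        (\<Union>n. \<Union>x\<in>P n. costar_inters X (\<D> n) x) \<in> coll_compl X \<B>"
      by blast
  qed
next
  assume SDS: "SDS_fin X (coll_compl X \<A>) (coll_compl X \<B>)"
  show "SCS_fin X \<A> \<B>"
    unfolding SCS_fin_def
  proof (intro allI impI)
    fix \<U> :: "nat \<Rightarrow> 'a set set"
    assume \<U>: "\<forall>n. \<U> n \<in> \<A>"
    then have "\<forall>n. fam_compl X (\<U> n) \<in> coll_compl X \<A>"
      by (auto simp: coll_compl_def)
    then obtain P where P: "\<forall>n. finite (P n) \<and> P n \<subseteq> X"
        "(\<Union>n. \<Union>x\<in>P n. costar_inters X (fam_compl X (\<U> n)) x) \<in> coll_compl X \<B>"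
      using SDS[unfolded SDS_fin_def, rule_format, of "\<lambda>n. fam_compl X (\<U> n)"] by blast
    have "\<U> n \<subseteq> Pow X" for n
      using assms(1) \<U> by blast
    then have "(\<Union>n. \<Union>x\<in>P n. star_unions (\<U> n) x) \<in> \<B>"
      using costar_selection_iff_star_selection[OF assms(2), of \<U> P] P by simp
    with P(1) show "\<exists>P. (\<forall>n. finite (P n) \<and> P n \<subseteq> X) \<and>
        (\<Union>n. \<Union>x\<in>P n. star_unions (\<U> n) x) \<in> \<B>"
      by blast
  qed
qed

end
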